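(* Let $K\subset\mathbb{C}$ be a compact set with $0\notin K$. Then there exists $r_0=r_0(K)<\infty$ such that for every sequence $(\phi_n)_{n\ge0}$ with $\phi_n\in K$ for each $n$, the entire function $$g(z)=\sum_{n\ge0}\phi_n\frac{z^n}{\sqrt{n!}}$$ vanishes somewhere in the disk $\{|z|\le r_0\}$. *)

theory Defs
  imports "HOL-Complex_Analysis.Complex_Analysis"
begin

definition g_series :: "(nat \<Rightarrow> complex) \<Rightarrow> complex \<Rightarrow> complex" where
  "g_series \<phi> z = (\<Sum>n. \<phi> n * (z ^ n / of_real (sqrt (fact n))))"

text \<open>
  For bounded coefficients (in particular, coefficients in a compact set) the series
  converges everywhere, so \<^const>\<open>suminf\<close> is its genuine sum, and the sum is entire.
\<close>

lemma g_series_summable: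
  fixes \<phi> :: "nat \<Rightarrow> complex"
  assumes "bounded (range \<phi>)"
  shows "summable (\<lambda>n. \<phi> n * (z ^ n / of_real (sqrt (fact n))))"
proof -
  obtain M where M: "\<And>n. norm (\<phi> n) \<le> M"
    using assms unfolding bounded_iff by auto
  define x where "x = norm z"
  have x: "x \<ge> 0" by (simp add: x_def)
  define N where "N = nat \<lceil>(2 * x)\<^sup>2\<rceil>"
  have "summable (\<lambda>n. x ^ n / sqrt (fact n))"
  proof (rule summable_ratio_test[of "1/2" N])
    fix n assume "n \<ge> N"
    hence "(2 * x)\<^sup>2 \<le> real (Suc n)"
      unfolding N_def by linarith
    hence le: "2 * x \<le> sqrt (real (Suc n))"
      by (rule real_le_rsqrt)
    have pos: "sqrt (real (Suc n)) > 0" by simp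
    have "x / sqrt (real (Suc n)) \<le> 1/2"
      using le pos by (simp add: divide_le_eq)
    hence "x / sqrt (real (Suc n)) * (x ^ n / sqrt (fact n)) \<le> 1/2 * (x ^ n / sqrt (fact n))"
      using x by (intro mult_right_mono) auto
    moreover have "x ^ Suc n / sqrt (fact (Suc n)) = x / sqrt (real (Suc n)) * (x ^ n / sqrt (fact n))"
      by (simp add: real_sqrt_mult del: of_nat_Suc)
    ultimately have "x ^ Suc n / sqrt (fact (Suc n)) \<le> 1/2 * (x ^ n / sqrt (fact n))"
      by (simp only:)
    moreover have "norm (x ^ k / sqrt (fact k)) = x ^ k / sqrt (fact k)" for k
      using x by simp
    ultimately show "norm (x ^ Suc n / sqrt (fact (Suc n))) \<le> 1/2 * norm (x ^ n / sqrt (fact n))"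
      by (simp only:)
  qed simp
  hence "summable (\<lambda>n. M * (x ^ n / sqrt (fact n)))"
    by (rule summable_mult)
  thus ?thesis
  proof (rule summable_comparison_test'[where N = 0])
    fix n :: nat
    have "norm (\<phi> n) * (x ^ n / sqrt (fact n)) \<le> M * (x ^ n / sqrt (fact n))"
      using M x by (intro mult_right_mono) auto
    thus "norm (\<phi> n * (z ^ n / of_real (sqrt (fact n)))) \<le> M * (x ^ n / sqrt (fact n))"
      by (simp add: norm_mult norm_divide norm_power x_def)
  qed
qed

lemma g_series_holomorphic:
  fixes \<phi> :: "nat \<Rightarrow> complex"
  assumes "bounded (range \<phi>)"
  shows "g_series \<phi> holomorphic_on UNIV"
proof -
  have "g_series \<phi> holomorphic_on ball 0 r" for r
  proof (rule power_series_holomorphic[where a = "\<lambda>n. \<phi> n / of_real (sqrt (fact n))"])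
    fix w
    show "(\<lambda>n. \<phi> n / of_real (sqrt (fact n)) * (w - 0) ^ n) sums g_series \<phi> w"
      using summable_sums[OF g_series_summable[OF assms, of w]]
      by (simp add: g_series_def mult.commute)
  qed
  hence "g_series \<phi> field_differentiable at z" for z
    using holomorphic_on_imp_differentiable_at[of "g_series \<phi>" "ball 0 (norm z + 1)" z] by simp
  thus ?thesis
    by (auto simp: holomorphic_on_def intro: field_differentiable_at_within)
qed

end

theory Submission
  imports Defs "HOL-Real_Asymp.Real_Asymp"
begin

text \<open>
  By Montel and Hurwitz, if no radius works then some entire limit \<open>g = \<Sum>n. x n * z ^ n / sqrt (fact n)\<close>
  with \<open>m \<le> norm (x n) \<le> M\<close> has no zero at all.  Since \<open>norm (g z)\<close> is at most
  \<open>C * exp (D * (norm z)\<^sup>2)\<close>, such a \<open>g\<close> is the exponential of a quadratic polynomial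
  \<open>a + b * z + c * z\<^sup>2\<close>, so \<open>g' = (b + 2 * c * z) * g\<close> gives
  \<open>sqrt (n + 2) * x (n + 2) = b * x (n + 1) + 2 * c * sqrt (n + 1) * x n\<close>.
  This is incompatible with the two-sided bound: \<open>x\<close> decays if \<open>norm (2 * c) < 1\<close> and explodes if
  \<open>norm (2 * c) > 1\<close>; if \<open>norm (2 * c) = 1\<close>, a rotation reduces to \<open>2 * c = 1\<close>, where
  a bounded quantity built from the \<open>norm (x n)\<^sup>2\<close> drops by a multiple of \<open>1 / n\<close> in each step.
\<close>

section \<open>Real sequences: geometric comparison and harmonic decrease\<close>

lemma two_step_geometric_le:
  fixes e :: "nat \<Rightarrow> real"
  assumes "\<And>n. n \<ge> N \<Longrightarrow> e (n + 2) \<le> q * e n" and "q \<ge> 0"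
  shows "e (N + 2 * k) \<le> q ^ k * e N"
proof (induction k)
  case (Suc k)
  have "e (N + 2 * Suc k) \<le> q * e (N + 2 * k)"
    using assms(1)[of "N + 2 * k"] by simp
  also have "\<dots> \<le> q * (q ^ k * e N)"
    using Suc assms(2) by (intro mult_left_mono)
  finally show ?case by simp
qed simp

lemma two_step_geometric_ge:
  fixes e :: "nat \<Rightarrow> real"
  assumes "\<And>n. n \<ge> N \<Longrightarrow> q * e n \<le> e (n + 2)" and "q \<ge> 0"
  shows "q ^ k * e N \<le> e (N + 2 * k)"
proof (induction k)
  case (Suc k)
  have "q * (q ^ k * e N) \<le> q * e (N + 2 * k)"
    using Suc assms(2) by (intro mult_left_mono)
  also have "\<dots> \<le> e (N + 2 * Suc k)"
    using assms(1)[of "N + 2 * k"] by simp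
  finally show ?case by simp
qed simp

text \<open>Telescoping would bound all partial sums of a tail of the harmonic series by
  \<open>2 * B / \<delta>\<close>, contradicting its divergence.\<close>

lemma harmonic_decrease_unbounded:
  fixes V :: "nat \<Rightarrow> real"
  assumes "\<delta> > 0" and dec: "\<And>n. n \<ge> N \<Longrightarrow> V (Suc n) \<le> V n - \<delta> / (real n + 1)"
    and bd: "\<And>n. \<bar>V n\<bar> \<le> B"
  shows False
proof -
  have tel: "(\<Sum>k<j. \<delta> / (real (k + N) + 1)) \<le> V N - V (j + N)" for j
  proof (induction j)
    case (Suc j)
    thus ?case using dec[of "j + N"] by simp
  qed simp
  have "(\<Sum>k<j. \<delta> / (real (k + N) + 1)) \<le> 2 * B" for j
    using tel[of j] bd[of N] bd[of "j + N"] by (simp add: abs_le_iff)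
  hence "summable (\<lambda>k. \<delta> / (real (k + N) + 1))"
    using \<open>\<delta> > 0\<close> by (intro summableI_nonneg_bounded[of _ "2 * B"]) auto
  hence "summable (\<lambda>k. \<delta> / (real k + 1))"
    by (subst (asm) summable_iff_shift)
  hence "summable (\<lambda>k. inverse \<delta> * (\<delta> / (real k + 1)))"
    by (rule summable_mult)
  hence "summable (\<lambda>k. inverse (real (Suc k)))"
    using \<open>\<delta> > 0\<close> by (simp add: field_simps)
  thus False
    using not_summable_harmonic[where 'a = real] by (subst (asm) summable_Suc_iff) simp
qed

section \<open>The three-term recurrence under two-sided bounds\<close>

text \<open>This is the critical case: there is no geometric growth or decay to exploit, so effects
  of relative order \<open>1 / n\<close> decide. The factors \<open>real n + 2\<close> and
  \<open>real n + 1\<close> in \<open>E_rec\<close> supply a loss of that order; the work lies in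
  showing that the terms with \<open>b\<close> cannot make up for it.\<close>

lemma no_two_sided_bounds_unit_coeff:
  fixes x :: "nat \<Rightarrow> complex" and b :: complex
  assumes rec: "\<And>n. of_real (sqrt (real n + 2)) * x (n + 2) = b * x (n + 1) + of_real (sqrt (real n + 1)) * x n"
    and m: "0 < m" "\<And>n. m \<le> norm (x n)" and M: "\<And>n. norm (x n) \<le> M"
  shows False
proof -
  define E where "E n = (norm (x n))\<^sup>2" for n
  text \<open>
    The recurrence makes \<^term>\<open>Re (P n)\<close> change by \<^term>\<open>Re b * E n\<close> in each step, that is, linearly
    in total, while \<^term>\<open>P n\<close> is only of size \<^term>\<open>sqrt (real n)\<close>.  Once \<^term>\<open>Re b = 0\<close>, the
    increments of \<^term>\<open>Im (P n)\<close> are exactly what enters the recurrence of \<^term>\<open>E n\<close>.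
  \<close>
  define P where "P n = of_real (sqrt (real n + 1)) * x (n + 1) * cnj (x n)" for n
  have cE: "complex_of_real (E n) = x n * cnj (x n)" for n
    unfolding E_def by (metis complex_norm_square)
  have Em: "m\<^sup>2 \<le> E n" and EM: "E n \<le> M\<^sup>2" and E0: "0 \<le> E n" for n
    using m M by (auto simp: E_def intro!: power_mono)
  have M0: "0 < M" using m(1) m(2)[of 0] M[of 0] by linarith
  have normP: "norm (P n) \<le> M\<^sup>2 * sqrt (real n + 1)" for n
  proof -
    have "norm (P n) = sqrt (real n + 1) * (norm (x (n + 1)) * norm (x n))"
      by (simp add: P_def norm_mult)
    also have "\<dots> \<le> sqrt (real n + 1) * (M * M)"
      using M M0 by (intro mult_left_mono mult_mono) auto
    finally show ?thesis by (simp add: power2_eq_square mult_ac)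
  qed
  \<comment> \<open>Multiplying the recurrence by \<open>cnj (x (n + 1))\<close> turns its last term
    into \<open>cnj (P n)\<close>. Conjugation keeps the real part, which therefore accumulates, and
    flips the imaginary part.\<close>
  have P_Suc: "P (Suc n) = b * of_real (E (Suc n)) + cnj (P n)" for n
  proof -
    have "P (Suc n) = (of_real (sqrt (real n + 2)) * x (n + 2)) * cnj (x (n + 1))"
      by (simp add: P_def add_ac)
    also have "\<dots> = b * (x (n + 1) * cnj (x (n + 1))) + of_real (sqrt (real n + 1)) * x n * cnj (x (n + 1))"
      by (subst rec) (simp add: algebra_simps)
    also have "\<dots> = b * of_real (E (Suc n)) + cnj (P n)"
      unfolding cE by (simp add: P_def)
    finally show ?thesis .
  qed
  \<comment> \<open>The squared modulus of both sides of the recurrence; the cross terms add up to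
    \<open>2 * Re (b * P n)\<close>.\<close>
  have E_rec: "(real n + 2) * E (n + 2) = (real n + 1) * E n + (norm b)\<^sup>2 * E (n + 1) + 2 * Re (b * P n)" for n
  proof -
    have "(sqrt (real n + 2))\<^sup>2 = real n + 2" by simp
    hence "complex_of_real ((real n + 2) * E (n + 2)) =
        of_real ((sqrt (real n + 2))\<^sup>2) * (x (n + 2) * cnj (x (n + 2)))"
      by (simp only: of_real_mult cE)
    also have "\<dots> = (of_real (sqrt (real n + 2)) * x (n + 2)) * cnj (of_real (sqrt (real n + 2)) * x (n + 2))"
      by (simp only: power2_eq_square of_real_mult complex_cnj_mult complex_cnj_complex_of_real mult_ac)
    also have "\<dots> = of_real (sqrt (real n + 1)) * of_real (sqrt (real n + 1)) * (x n * cnj (x n))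
        + b * cnj b * (x (n + 1) * cnj (x (n + 1))) + (b * P n + cnj (b * P n))"
      unfolding rec P_def complex_cnj_add complex_cnj_mult complex_cnj_complex_of_real complex_cnj_cnj
      by (simp only: ring_distribs mult_ac add_ac)
    also have "of_real (sqrt (real n + 1)) * of_real (sqrt (real n + 1)) = complex_of_real (real n + 1)"
      by (simp flip: of_real_mult)
    also have "complex_of_real (real n + 1) * (x n * cnj (x n)) + b * cnj b * (x (n + 1) * cnj (x (n + 1)))
        + (b * P n + cnj (b * P n)) = complex_of_real ((real n + 1) * E n + (norm b)\<^sup>2 * E (n + 1) + 2 * Re (b * P n))"
      unfolding complex_add_cnj of_real_add of_real_mult cE complex_norm_square by simp
    finally show ?thesis by (simp only: of_real_eq_iff)
  qed
  have Reb: "Re b = 0"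
  proof (rule ccontr)
    assume nz: "Re b \<noteq> 0"
    define s where "s = sgn (Re b)"
    have s: "s * Re b = \<bar>Re b\<bar>" "\<bar>s\<bar> = 1" using nz by (auto simp: s_def sgn_if)
    \<comment> \<open>The sign \<open>s\<close> makes every increment at least
      \<open>\<bar>Re b\<bar> * m\<^sup>2\<close>. The resulting linear growth contradicts
      \<open>normP\<close>.\<close>
    have lower: "s * Re (P n) \<ge> s * Re (P 0) + \<bar>Re b\<bar> * m\<^sup>2 * real n" for n
    proof (induction n)
      case (Suc n)
      have "s * Re (P (Suc n)) = \<bar>Re b\<bar> * E (Suc n) + s * Re (P n)"
        by (simp add: P_Suc algebra_simps flip: s(1))
      moreover have "\<bar>Re b\<bar> * m\<^sup>2 \<le> \<bar>Re b\<bar> * E (Suc n)" by (intro mult_left_mono Em) auto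
      ultimately show ?case using Suc by (simp add: algebra_simps)
    qed simp
    have upper: "\<bar>s * Re (P n)\<bar> \<le> M\<^sup>2 * sqrt (real n + 1)" for n
      using order.trans[OF abs_Re_le_cmod normP] s(2) by (simp add: abs_mult)
    have up: "\<bar>Re b\<bar> * m\<^sup>2 * real n \<le> M\<^sup>2 * sqrt (real n + 1) + M\<^sup>2" for n
      using lower[of n] upper[of n] upper[of 0] by (simp add: abs_le_iff)
    have "\<bar>Re b\<bar> * m\<^sup>2 > 0" "M\<^sup>2 > 0" using nz m(1) M0 by auto
    hence "eventually (\<lambda>n. \<bar>Re b\<bar> * m\<^sup>2 * real n > M\<^sup>2 * sqrt (real n + 1) + M\<^sup>2) sequentially"
      by real_asymp
    thus False using up by (auto simp: eventually_sequentially not_less[symmetric])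
  qed
  define \<beta> where "\<beta> = Im b"
  have b: "b = \<i> * of_real \<beta>" using Reb by (simp add: complex_eq_iff \<beta>_def)
  define Q where "Q n = Im (P n)" for n
  have Q_Suc: "Q (Suc n) = \<beta> * E (Suc n) - Q n" for n
    by (simp add: Q_def P_Suc b)
  have normQ: "\<bar>Q n\<bar> \<le> M\<^sup>2 * sqrt (real n + 1)" for n
    unfolding Q_def using order.trans[OF abs_Im_le_cmod normP] .
  \<comment> \<open>By \<open>Q_Suc\<close>,
    \<open>\<beta>\<^sup>2 * E (n + 1) - 2 * \<beta> * Q n\<close> is \<open>\<beta>\<close> times
    the increment of \<open>Q\<close>.\<close>
  have E_rec': "(real n + 2) * E (n + 2) = (real n + 1) * E n + \<beta> * (Q (Suc n) - Q n)" for n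
  proof -
    have "Re (b * P n) = - \<beta> * Q n" by (simp add: b Q_def)
    moreover have "(norm b)\<^sup>2 = \<beta>\<^sup>2" by (simp add: b norm_mult)
    ultimately show ?thesis
      unfolding E_rec Q_Suc by (simp add: algebra_simps power2_eq_square)
  qed
  text \<open>Summation by parts: the correction term absorbs the increments of \<^term>\<open>Q n\<close>.\<close>
  define V where "V n = E (n + 1) + E n - \<beta> * Q n / (real n + 1)" for n
  \<comment> \<open>The term \<open>E (n + 2) / (real n + 1)\<close> is the harmonic loss. The last
    term is what remains when the denominator under \<open>Q (Suc n)\<close> changes from
    \<open>real n + 1\<close> to \<open>real n + 2\<close>; by \<open>normQ\<close> it is of the
    smaller order \<open>n powr (-3/2)\<close>.\<close>
  have V_Suc: "V (Suc n) = V n - E (n + 2) / (real n + 1) + \<beta> * Q (Suc n) / ((real n + 1) * (real n + 2))" for n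
  proof -
    have "(real n + 1) * (E (n + 2) - E n) = \<beta> * (Q (Suc n) - Q n) - E (n + 2)"
      using E_rec'[of n] by (simp add: algebra_simps)
    hence "E (n + 2) - E n = (\<beta> * (Q (Suc n) - Q n) - E (n + 2)) / (real n + 1)"
      by (metis nonzero_mult_div_cancel_left of_nat_Suc of_nat_neq_0 add.commute)
    hence "E (n + 2) - E n = \<beta> * Q (Suc n) / (real n + 1) - \<beta> * Q n / (real n + 1) - E (n + 2) / (real n + 1)"
      by (simp add: diff_divide_distrib right_diff_distrib)
    moreover have "\<beta> * Q (Suc n) / ((real n + 1) * (real n + 2)) =
        \<beta> * Q (Suc n) / (real n + 1) - \<beta> * Q (Suc n) / (real n + 2)"
      by (simp add: field_simps)
    ultimately show ?thesis
      by (simp add: V_def add_ac)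
  qed
  \<comment> \<open>From \<open>N\<close> on, the remainder in \<open>V_Suc\<close> eats up at most
    half of the loss, which is at least \<open>m\<^sup>2 / (real n + 1)\<close>; hence the constant
    \<open>m\<^sup>2 / 2\<close> below.\<close>
  have small: "eventually (\<lambda>n. \<bar>\<beta>\<bar> * M\<^sup>2 * sqrt (real n + 2) / (real n + 2) \<le> m\<^sup>2 / 2) sequentially"
  proof -
    have "(\<lambda>n. \<bar>\<beta>\<bar> * M\<^sup>2 * (sqrt (real n + 2) / (real n + 2))) \<longlonglongrightarrow> \<bar>\<beta>\<bar> * M\<^sup>2 * 0"
      by (intro tendsto_mult tendsto_const) real_asymp
    hence "eventually (\<lambda>n. \<bar>\<beta>\<bar> * M\<^sup>2 * (sqrt (real n + 2) / (real n + 2)) < m\<^sup>2 / 2) sequentially"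
      using m(1) by (intro order_tendstoD) auto
    thus ?thesis by eventually_elim simp
  qed
  then obtain N where N: "\<And>n. n \<ge> N \<Longrightarrow> \<bar>\<beta>\<bar> * M\<^sup>2 * sqrt (real n + 2) / (real n + 2) \<le> m\<^sup>2 / 2"
    by (auto simp: eventually_sequentially)
  show False
  proof (rule harmonic_decrease_unbounded)
    show "m\<^sup>2 / 2 > 0" using m(1) by simp
    fix n assume "n \<ge> N"
    have "\<beta> * Q (Suc n) \<le> \<bar>\<beta>\<bar> * (M\<^sup>2 * sqrt (real n + 2))"
      using mult_left_mono[OF normQ[of "Suc n"], of "\<bar>\<beta>\<bar>"]
      by (simp add: abs_mult[symmetric] add_ac)
    hence "\<beta> * Q (Suc n) / (real n + 2) \<le> \<bar>\<beta>\<bar> * M\<^sup>2 * sqrt (real n + 2) / (real n + 2)"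
      by (intro divide_right_mono) auto
    also have "\<dots> \<le> m\<^sup>2 / 2" by (rule N) fact
    finally have "\<beta> * Q (Suc n) / (real n + 2) / (real n + 1) \<le> m\<^sup>2 / 2 / (real n + 1)"
      by (intro divide_right_mono) auto
    hence "\<beta> * Q (Suc n) / ((real n + 1) * (real n + 2)) \<le> m\<^sup>2 / (real n + 1) / 2"
      by (simp add: mult.commute)
    moreover have "m\<^sup>2 / (real n + 1) \<le> E (n + 2) / (real n + 1)"
      by (intro divide_right_mono Em) auto
    moreover have "m\<^sup>2 / 2 / (real n + 1) = m\<^sup>2 / (real n + 1) / 2"
      by simp
    moreover have "v - y + a \<le> v - w / 2" if "a \<le> w / 2" "w \<le> y" for v y a w :: real
      using that by linarith
    ultimately show "V (Suc n) \<le> V n - m\<^sup>2 / 2 / (real n + 1)"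
      unfolding V_Suc by metis
  next
    fix n
    have "\<bar>Q n\<bar> \<le> M\<^sup>2 * (real n + 1)"
    proof -
      have "sqrt (real n + 1) \<le> real n + 1"
        by (rule real_le_lsqrt) (auto simp: power2_eq_square algebra_simps)
      thus ?thesis using normQ[of n] mult_left_mono[of "sqrt (real n + 1)" "real n + 1" "M\<^sup>2"] by simp
    qed
    hence "\<bar>\<beta> * Q n / (real n + 1)\<bar> \<le> \<bar>\<beta>\<bar> * M\<^sup>2"
      using mult_left_mono[of "\<bar>Q n\<bar>" "M\<^sup>2 * (real n + 1)" "\<bar>\<beta>\<bar>"]
      by (simp add: abs_mult divide_le_eq mult_ac)
    thus "\<bar>V n\<bar> \<le> 2 * M\<^sup>2 + \<bar>\<beta>\<bar> * M\<^sup>2"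
      unfolding V_def using E0[of n] E0[of "n+1"] EM[of n] EM[of "n+1"] by linarith
  qed
qed

text \<open>After division by \<open>sqrt (real n + 2)\<close> the \<open>b\<close> term tends to 0
  because \<open>x\<close> is bounded, so \<open>norm (x (n + 2))\<close> is close to
  \<open>norm c * norm (x n)\<close> and the size of \<open>norm c\<close> decides. Here
  \<open>c\<close> stands for twice the quadratic coefficient of the exponent.\<close>

lemma no_two_sided_bounds:
  fixes x :: "nat \<Rightarrow> complex" and b c :: complex
  assumes rec: "\<And>n. of_real (sqrt (real n + 2)) * x (n + 2) = b * x (n + 1) + c * of_real (sqrt (real n + 1)) * x n"
    and m: "0 < m" "\<And>n. m \<le> norm (x n)" and M: "\<And>n. norm (x n) \<le> M"
  shows False
proof -
  define e where "e n = norm (x n)" for n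
  define k where "k n = sqrt (real n + 1) / sqrt (real n + 2)" for n
  have k: "0 < k n" "k n \<le> 1" for n by (auto simp: k_def)
  have M0: "0 < M" using m(1) m(2)[of 0] M[of 0] by linarith
  have dist: "\<bar>e (n + 2) - norm c * k n * e n\<bar> \<le> norm b * M / sqrt (real n + 2)" for n
  proof -
    have s: "complex_of_real (sqrt (real n + 2)) \<noteq> 0" 
      by (metis of_real_eq_0_iff real_sqrt_eq_zero_cancel_iff add_nonneg_pos of_nat_0_le_iff zero_less_numeral less_irrefl)
    have "x (n + 2) - c * of_real (k n) * x n = b * x (n + 1) / of_real (sqrt (real n + 2))"
      using rec[of n] s by (simp add: k_def field_simps)
    hence "norm (x (n + 2) - c * of_real (k n) * x n) = norm b * e (n + 1) / sqrt (real n + 2)"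
      by (simp add: norm_mult norm_divide e_def)
    also have "\<dots> \<le> norm b * M / sqrt (real n + 2)"
      using M by (intro divide_right_mono mult_left_mono) (auto simp: e_def)
    finally have "norm (x (n + 2) - c * of_real (k n) * x n) \<le> norm b * M / sqrt (real n + 2)" .
    moreover have "norm (c * of_real (k n) * x n) = norm c * k n * e n"
      using k[of n] by (simp add: norm_mult e_def)
    ultimately show ?thesis
      using norm_triangle_ineq3[of "x (n + 2)" "c * of_real (k n) * x n"] unfolding e_def by linarith
  qed
  have lim0: "(\<lambda>n. norm b * M / sqrt (real n + 2)) \<longlonglongrightarrow> 0" by real_asymp
  have limk: "(\<lambda>n. norm c * k n) \<longlonglongrightarrow> norm c * 1"
    unfolding k_def by (intro tendsto_mult tendsto_const) real_asymp
  consider "norm c < 1" | "norm c = 1" | "norm c > 1" by linarith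
  thus False
  proof cases
    case 1
    \<comment> \<open>A ratio strictly between \<open>norm c\<close> and 1: since
      \<open>m \<le> e n\<close>, the gap \<open>(q - norm c) * e n\<close> eventually absorbs the
      error in \<open>dist\<close>.\<close>
    define q where "q = (1 + norm c) / 2"
    have q: "0 \<le> q" "q < 1" "norm c < q" using 1 by (auto simp: q_def)
    have "eventually (\<lambda>n. norm b * M / sqrt (real n + 2) < (q - norm c) * m) sequentially"
      using q m(1) by (intro order_tendstoD[OF lim0]) auto
    then obtain N where N: "\<And>n. n \<ge> N \<Longrightarrow> norm b * M / sqrt (real n + 2) < (q - norm c) * m"
      by (auto simp: eventually_sequentially)
    have "e (n + 2) \<le> q * e n" if "n \<ge> N" for n
    proof -
      have "norm c * k n * e n \<le> norm c * 1 * e n"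
        using k by (intro mult_right_mono mult_left_mono) (auto simp: e_def)
      moreover have "(q - norm c) * m \<le> (q - norm c) * e n"
        using q m by (intro mult_left_mono) (auto simp: e_def)
      ultimately show ?thesis using N[OF that] dist[of n] by (simp add: algebra_simps abs_le_iff)
    qed
    hence "e (N + 2 * j) \<le> q ^ j * e N" for j using q by (intro two_step_geometric_le) auto
    hence "m \<le> q ^ j * e N" for j using m(2)[of "N + 2 * j"] unfolding e_def using order.trans by blast
    moreover have "(\<lambda>j. q ^ j * e N) \<longlonglongrightarrow> 0 * e N"
      using q by (intro tendsto_mult tendsto_const LIMSEQ_power_zero) auto
    ultimately have "m \<le> 0 * e N" by (intro LIMSEQ_le_const) auto
    thus False using m(1) by simp
  next
    case 2
    \<comment> \<open>The sequence \<open>u ^ n * x n\<close> has the same moduli as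
      \<open>x\<close> and satisfies the recurrence with \<open>u * b\<close> for \<open>b\<close>
      and \<open>u * u * c = 1\<close> for \<open>c\<close>.\<close>
    define u where "u = csqrt (inverse c)"
    have c: "c \<noteq> 0" using 2 by auto
    have uu: "u * u = inverse c" unfolding u_def by (metis power2_csqrt power2_eq_square)
    have "(norm u)\<^sup>2 = 1" using 2 by (simp add: power2_eq_square norm_inverse uu flip: norm_mult)
    hence nu: "norm u = 1" by (intro power2_eq_imp_eq[of "norm u" 1]) auto
    show False
    proof (rule no_two_sided_bounds_unit_coeff)
      fix n
      have "of_real (sqrt (real n + 2)) * (u ^ (n + 2) * x (n + 2)) = u ^ (n + 2) * (of_real (sqrt (real n + 2)) * x (n + 2))"
        by (simp only: mult_ac)
      also have "\<dots> = u * b * (u ^ (n + 1) * x (n + 1)) + (u * u * c) * of_real (sqrt (real n + 1)) * (u ^ n * x n)"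
        unfolding rec by (simp add: algebra_simps)
      finally show "of_real (sqrt (real n + 2)) * (u ^ (n + 2) * x (n + 2)) =
          u * b * (u ^ (n + 1) * x (n + 1)) + of_real (sqrt (real n + 1)) * (u ^ n * x n)"
        using c by (simp add: uu)
    qed (use m M in \<open>auto simp: norm_mult norm_power nu\<close>)
  next
    case 3
    define q where "q = (1 + norm c) / 2"
    have q: "1 < q" "q < norm c" using 3 by (auto simp: q_def)
    \<comment> \<open>Two gaps are needed above the ratio \<open>q\<close>: the one from
      \<open>p\<close> to \<open>norm c\<close> allows for \<open>k n\<close> being below 1, the one
      from \<open>q\<close> to \<open>p\<close> for the error in \<open>dist\<close>.\<close>
    define p where "p = (q + norm c) / 2"
    have p: "q < p" "p < norm c" using q by (auto simp: p_def)
    have "eventually (\<lambda>n. norm b * M / sqrt (real n + 2) < (p - q) * m \<and> p < norm c * k n) sequentially"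
      using p m(1) by (intro eventually_conj order_tendstoD(2)[OF lim0] order_tendstoD(1)[OF limk]) auto
    then obtain N where N: "\<And>n. n \<ge> N \<Longrightarrow> norm b * M / sqrt (real n + 2) < (p - q) * m \<and> p < norm c * k n"
      by (auto simp: eventually_sequentially)
    have "q * e n \<le> e (n + 2)" if "n \<ge> N" for n
    proof -
      have "p * e n \<le> norm c * k n * e n"
        using N[OF that] by (intro mult_right_mono) (auto simp: e_def)
      moreover have "(p - q) * m \<le> (p - q) * e n"
        using p m by (intro mult_left_mono) (auto simp: e_def)
      ultimately show ?thesis using N[OF that] dist[of n] by (simp add: algebra_simps abs_le_iff)
    qed
    hence *: "q ^ j * e N \<le> e (N + 2 * j)" for j using q by (intro two_step_geometric_ge) auto
    have "q ^ j * m \<le> M" for j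
    proof -
      have "q ^ j * m \<le> q ^ j * e N" using q m by (intro mult_left_mono) (auto simp: e_def)
      thus ?thesis using *[of j] M[of "N + 2 * j"] unfolding e_def by linarith
    qed
    moreover obtain j where "M / m < q ^ j" using real_arch_pow[OF q(1)] by blast
    ultimately show False using m(1) by (simp add: divide_less_eq not_less[symmetric])
  qed
qed

section \<open>Entire functions with quadratically bounded real part\<close>

text \<open>An upper bound on the real part alone already controls the modulus, at the cost of
  doubling the radius. So \<open>h\<close> itself grows at most quadratically, and Liouville's
  theorem for polynomial growth applies.\<close>

lemma quadratic_of_Re_le:
  fixes h :: "complex \<Rightarrow> complex"
  assumes holo: "h holomorphic_on UNIV" and "B \<ge> 0"
    and Re_le: "\<And>z. Re (h z) \<le> A + B * (norm z)\<^sup>2"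
  shows "\<exists>a b c. \<forall>z. h z = a + b * z + c * z\<^sup>2"
proof -
  define f where "f z = h z - h 0" for z
  \<comment> \<open>The summand 1 makes \<open>f_Re\<close> strict and keeps \<open>T\<close> below
    positive even when \<open>B = 0\<close>.\<close>
  define A' where "A' = \<bar>A\<bar> + norm (h 0) + 1"
  have A': "A' \<ge> 1" by (simp add: A'_def)
  have f_holo: "f holomorphic_on UNIV" unfolding f_def by (intro holomorphic_intros holo)
  have f_Re: "Re (f z) < A' + B * (norm z)\<^sup>2" for z
    using Re_le[of z] abs_Re_le_cmod[of "h 0"] by (simp add: f_def A'_def)
  have f_bound: "norm (f z) \<le> 2 * (A' + 4 * B * (norm z)\<^sup>2)" if "z \<noteq> 0" for z
  proof -
    \<comment> \<open>With this radius \<open>z\<close> corresponds to a point \<open>w\<close> of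
      modulus 1/2, so the Schwarz lemma gives \<open>norm (F w) \<le> 1 / 2\<close>. Solving for
      \<open>f z\<close> yields \<open>norm (f z) \<le> 2 * T\<close>.\<close>
    define R where "R = 2 * norm z"
    define T where "T = A' + B * R\<^sup>2"
    have R: "R > 0" using that by (simp add: R_def)
    have T: "T > 0" using A' \<open>B \<ge> 0\<close> by (simp add: T_def add_pos_nonneg)
    have Re_T: "Re (f (of_real R * w)) < T" if "norm w < 1" for w
    proof -
      have "(norm (of_real R * w))\<^sup>2 \<le> R\<^sup>2"
        using R that by (intro power_mono) (auto simp: norm_mult)
      hence "B * (norm (of_real R * w))\<^sup>2 \<le> B * R\<^sup>2"
        using \<open>B \<ge> 0\<close> by (intro mult_left_mono)
      thus ?thesis using f_Re[of "of_real R * w"] by (simp add: T_def)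
    qed
    have nz: "2 * of_real T - f (of_real R * w) \<noteq> 0" if "norm w < 1" for w
    proof
      assume "2 * of_real T - f (of_real R * w) = 0"
      hence "Re (2 * of_real T - f (of_real R * w)) = 0" by (simp only: zero_complex.sel)
      thus False using Re_T[OF that] T by simp
    qed
    text \<open>Borel--Caratheodory: \<^term>\<open>F\<close> maps the unit disc into itself, since \<^term>\<open>Re (f (of_real R * w)) < T\<close> there.\<close>
    define F where "F w = f (of_real R * w) / (2 * of_real T - f (of_real R * w))" for w
    define w where "w = z / of_real R"
    have w: "norm w = 1 / 2" "of_real R * w = z"
      using that by (auto simp: w_def R_def norm_divide norm_mult)
    have "norm (F w) \<le> norm w"
    proof (rule Schwarz_Lemma(1))
      have comp: "(\<lambda>w. f (of_real R * w)) holomorphic_on ball 0 1"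
        using holomorphic_on_compose_gen[OF _ f_holo, of "\<lambda>w. of_real R * w" "ball 0 1"]
        by (auto simp: o_def intro!: holomorphic_intros)
      show "F holomorphic_on ball 0 1"
        unfolding F_def using nz by (intro holomorphic_intros comp) auto
      show "F 0 = 0" by (simp add: F_def f_def)
      fix v :: complex assume v: "norm v < 1"
      define y where "y = f (of_real R * v)"
      \<comment> \<open>The difference of the two squares is
        \<open>4 * T * (T - Re y)\<close>.\<close>
      have "(norm y)\<^sup>2 < (norm (2 * of_real T - y))\<^sup>2"
        using Re_T[OF v] T unfolding cmod_power2
        by (simp add: y_def power2_eq_square algebra_simps)
      hence "norm y < norm (2 * of_real T - y)"
        by (rule power_less_imp_less_base) simp
      thus "norm (F v) < 1" by (simp add: F_def norm_divide y_def divide_less_eq)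
    qed (simp add: w)
    hence "norm (f z) \<le> norm (2 * of_real T - f z) / 2"
      using nz[of w] by (simp add: F_def w norm_divide divide_le_eq)
    also have "\<dots> \<le> (2 * T + norm (f z)) / 2"
      using norm_triangle_ineq4[of "2 * of_real T" "f z"] T by (simp add: norm_mult)
    finally show ?thesis by (simp add: T_def R_def power_mult_distrib)
  qed
  have f_quad: "f z = (\<Sum>k\<le>2. (deriv ^^ k) f 0 / fact k * z ^ k)" for z
  proof (rule Liouville_polynomial[OF f_holo])
    fix z :: complex assume z: "1 \<le> norm z"
    hence "1 \<le> (norm z)\<^sup>2" by simp
    hence A'_le: "A' \<le> A' * (norm z)\<^sup>2" using A' mult_left_mono[of 1 "(norm z)\<^sup>2" A'] by simp
    have "norm (f z) \<le> 2 * (A' + 4 * B * (norm z)\<^sup>2)"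
    proof (rule f_bound)
      show "z \<noteq> 0" using z by auto
    qed
    also have "\<dots> \<le> 2 * (A' * (norm z)\<^sup>2 + 4 * B * (norm z)\<^sup>2)"
      using A'_le by simp
    finally show "norm (f z) \<le> 2 * (A' + 4 * B) * norm z ^ 2"
      by (simp add: algebra_simps)
  qed
  have "h z = (h 0 + f 0) + deriv f 0 * z + (deriv ^^ 2) f 0 / 2 * z\<^sup>2" for z
  proof -
    have "h z = h 0 + f z" by (simp add: f_def)
    also have "f z = f 0 + deriv f 0 * z + (deriv ^^ 2) f 0 / 2 * z\<^sup>2"
      by (subst f_quad) (simp add: numeral_2_eq_2)
    finally show ?thesis by (simp only: add.assoc)
  qed
  thus ?thesis by blast
qed

section \<open>Taylor coefficients and growth of the functions involved\<close>

text \<open>Leibniz's rule for \<open>g' = (b + 2 * c * z) * g\<close>: the linear factor has no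
  derivatives beyond the first, so only two terms survive. At 0 this is a recurrence for the Taylor
  coefficients of \<open>g\<close>.\<close>

lemma higher_deriv_exp_quadratic:
  fixes a b c :: complex
  defines "g \<equiv> \<lambda>z. exp (a + b * z + c * z\<^sup>2)"
  shows "(deriv ^^ Suc (Suc n)) g z =
    (b + 2 * c * z) * (deriv ^^ Suc n) g z + 2 * c * of_nat (Suc n) * (deriv ^^ n) g z"
proof -
  have "g holomorphic_on UNIV" unfolding g_def by (intro holomorphic_intros)
  hence D: "((deriv ^^ n) g has_field_derivative (deriv ^^ Suc n) g z) (at z)" for n z
    using has_field_derivative_higher_deriv[of g UNIV] by auto
  have D1: "deriv g z = (b + 2 * c * z) * g z" for z
    unfolding g_def by (rule DERIV_imp_deriv) (auto intro!: derivative_eq_intros)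
  show ?thesis
  proof (induction n arbitrary: z)
    case 0
    have "deriv (deriv g) z = deriv (\<lambda>z. (b + 2 * c * z) * g z) z"
      using D1 by presburger
    also have "\<dots> = (b + 2 * c * z) * deriv g z + 2 * c * g z"
      by (rule DERIV_imp_deriv) (use D[of 0 z] in \<open>auto intro!: derivative_eq_intros\<close>)
    finally show ?case by simp
  next
    case (Suc n)
    have "(deriv ^^ Suc (Suc (Suc n))) g z = deriv ((deriv ^^ Suc (Suc n)) g) z"
      by simp
    also have "(deriv ^^ Suc (Suc n)) g =
        (\<lambda>z. (b + 2 * c * z) * (deriv ^^ Suc n) g z + 2 * c * of_nat (Suc n) * (deriv ^^ n) g z)"
      by (intro ext Suc)
    also have "deriv \<dots> z = (b + 2 * c * z) * (deriv ^^ Suc (Suc n)) g z +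
        2 * c * of_nat (Suc (Suc n)) * (deriv ^^ Suc n) g z"
      by (rule DERIV_imp_deriv)
         (auto intro!: derivative_eq_intros D simp del: funpow.simps simp: algebra_simps)
    finally show ?case .
  qed
qed

text \<open>Growth of order two is what forces a logarithm of a zero-free limit to be quadratic.
  Each term is dominated by a geometric term plus a term of an exponential series; the sums are 2
  and \<open>exp (2 * x\<^sup>2)\<close>, and the latter is at least 1.\<close>

lemma cmod_g_series_le:
  assumes M: "\<And>n. norm (\<phi> n) \<le> M"
  shows "norm (g_series \<phi> z) \<le> 3 * M * exp (2 * (norm z)\<^sup>2)"
proof -
  define x where "x = norm z"
  have x: "0 \<le> x" by (simp add: x_def)
  have M0: "0 \<le> M" using M[of 0] norm_ge_zero order.trans by blast
  have bound: "x ^ n / sqrt (fact n) \<le> (1 / 2) ^ n + (2 * x\<^sup>2) ^ n / fact n" for n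
  proof -
    text \<open>AM-GM applied to the two summands on the right.\<close>
    define p q where "p = sqrt ((1 / 2) ^ n)" and "q = sqrt ((2 * x\<^sup>2) ^ n / fact n)"
    have "(1 / 2) ^ n * (2 * x\<^sup>2) ^ n = (1 / 2 * (2 * x\<^sup>2)) ^ n"
      by (rule power_mult_distrib[symmetric])
    also have "\<dots> = (x\<^sup>2) ^ n" by simp
    also have "\<dots> = (x ^ n)\<^sup>2" by (metis power_mult mult.commute)
    finally have "p * q = sqrt ((x ^ n)\<^sup>2 / fact n)"
      by (simp only: p_def q_def times_divide_eq_right flip: real_sqrt_mult)
    hence "x ^ n / sqrt (fact n) = p * q"
      using x by (simp add: real_sqrt_divide)
    also have "\<dots> \<le> p\<^sup>2 + q\<^sup>2"
    proof -
      have "0 \<le> p * q" by (simp add: p_def q_def)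
      thus ?thesis using sum_squares_bound[of p q] by simp
    qed
    also have "\<dots> = (1 / 2) ^ n + (2 * x\<^sup>2) ^ n / fact n"
      by (simp add: p_def q_def)
    finally show ?thesis .
  qed
  have "(\<lambda>n. (1 / 2) ^ n + (2 * x\<^sup>2) ^ n / fact n) sums (1 / (1 - 1 / 2) + exp (2 * x\<^sup>2))"
  proof (intro sums_add geometric_sums)
    show "(\<lambda>n. (2 * x\<^sup>2) ^ n / fact n) sums exp (2 * x\<^sup>2)"
      using exp_converges[of "2 * x\<^sup>2"] by (simp only: real_scaleR_def divide_inverse_commute)
  qed simp
  hence S: "(\<lambda>n. M * ((1 / 2) ^ n + (2 * x\<^sup>2) ^ n / fact n)) sums (M * (2 + exp (2 * x\<^sup>2)))"
    by (intro sums_mult) simp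
  have le: "norm (\<phi> n * (z ^ n / of_real (sqrt (fact n)))) \<le> M * ((1 / 2) ^ n + (2 * x\<^sup>2) ^ n / fact n)" for n
  proof -
    have "norm (\<phi> n * (z ^ n / of_real (sqrt (fact n)))) = norm (\<phi> n) * (x ^ n / sqrt (fact n))"
      by (simp add: norm_mult norm_divide norm_power x_def)
    also have "\<dots> \<le> M * ((1 / 2) ^ n + (2 * x\<^sup>2) ^ n / fact n)"
      using M M0 bound x by (intro mult_mono) auto
    finally show ?thesis .
  qed
  have "norm (g_series \<phi> z) \<le> M * (2 + exp (2 * x\<^sup>2))"
    unfolding g_series_def sums_unique[OF S] by (rule norm_suminf_le[OF le sums_summable[OF S]])
  also have "\<dots> \<le> M * (3 * exp (2 * x\<^sup>2))"
    using M0 by (intro mult_left_mono) auto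
  finally show ?thesis by (simp add: x_def)
qed

lemma higher_deriv_g_series:
  assumes "bounded (range \<phi>)"
  shows "(deriv ^^ n) (g_series \<phi>) 0 = \<phi> n * of_real (sqrt (fact n))"
proof -
  have "g_series \<phi> has_fps_expansion Abs_fps (\<lambda>n. \<phi> n / of_real (sqrt (fact n)))"
    using summable_sums[OF g_series_summable[OF assms]]
    by (intro has_fps_expansionI) (simp add: g_series_def)
  from fps_nth_fps_expansion[OF this, of n]
  have "(deriv ^^ n) (g_series \<phi>) 0 = \<phi> n * (fact n / of_real (sqrt (fact n)))"
    by (simp add: field_simps)
  also have "fact n / of_real (sqrt (fact n)) = complex_of_real (fact n / sqrt (fact n))"
    by simp
  also have "fact n / sqrt (fact n) = sqrt (fact n)"
    by (rule real_div_sqrt) simp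
  finally show ?thesis .
qed

section \<open>Existence of zeros, and a uniform radius by compactness\<close>

text \<open>The coefficient bounds are phrased through derivatives at 0 because these pass to
  locally uniform limits; the limit need not first be written as a \<open>g_series\<close>.\<close>

lemma entire_has_zero:
  fixes g :: "complex \<Rightarrow> complex"
  assumes holo: "g holomorphic_on UNIV"
    and growth: "\<And>z. norm (g z) \<le> C * exp (D * (norm z)\<^sup>2)" "0 < C" "0 \<le> D"
    and m: "0 < m" "\<And>n. m * sqrt (fact n) \<le> norm ((deriv ^^ n) g 0)"
    and M: "\<And>n. norm ((deriv ^^ n) g 0) \<le> M * sqrt (fact n)"
  shows "\<exists>z. g z = 0"
proof (rule ccontr)
  assume "\<nexists>z. g z = 0"
  then obtain h where h: "h holomorphic_on UNIV" "\<And>z. exp (h z) = g z"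
    using holomorphic_logarithm_exists[OF convex_UNIV open_UNIV holo, of 0] by auto
  have "Re (h z) \<le> ln C + D * (norm z)\<^sup>2" for z
  proof -
    have "exp (Re (h z)) \<le> exp (ln C + D * (norm z)\<^sup>2)"
      using growth(1)[of z] \<open>0 < C\<close> by (simp add: exp_add flip: h(2))
    thus ?thesis by simp
  qed
  from quadratic_of_Re_le[OF h(1) \<open>0 \<le> D\<close> this]
  obtain a b c where abc: "\<And>z. h z = a + b * z + c * z\<^sup>2" by blast
  have g: "g = (\<lambda>z. exp (a + b * z + c * z\<^sup>2))" by (simp add: fun_eq_iff abc flip: h(2))
  \<comment> \<open>By \<open>higher_deriv_g_series\<close>, this recovers \<open>\<phi> n\<close>
    when \<open>g\<close> is \<open>g_series \<phi>\<close> with bounded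
    \<open>\<phi>\<close>.\<close>
  define x where "x n = (deriv ^^ n) g 0 / of_real (sqrt (fact n))" for n
  have deriv_eq: "(deriv ^^ n) g 0 = of_real (sqrt (fact n)) * x n" for n
    by (simp add: x_def)
  have sqrt_fact_Suc: "sqrt (fact (Suc n)) = sqrt (real n + 1) * sqrt (fact n)" for n
    by (simp add: real_sqrt_mult add.commute)
  show False
  proof (rule no_two_sided_bounds)
    show "0 < m" by fact
    show "m \<le> norm (x n)" "norm (x n) \<le> M" for n
      using m(2)[of n] M[of n] by (simp_all add: x_def norm_divide field_simps)
    fix n
    \<comment> \<open>The normalising factors of three consecutive derivatives are \<open>r\<close>,
      \<open>s * r\<close> and \<open>t * (s * r)\<close>. Since
      \<open>s * s = of_nat (Suc n)\<close>, cancelling \<open>s * r\<close> leaves exactly the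
      recurrence of \<open>no_two_sided_bounds\<close>.\<close>
    define s t r where "s = complex_of_real (sqrt (real n + 1))"
      and "t = complex_of_real (sqrt (real n + 2))" and "r = complex_of_real (sqrt (fact n))"
    have r: "r \<noteq> 0" by (simp add: r_def)
    have "s \<noteq> 0" unfolding s_def of_real_eq_0_iff real_sqrt_eq_zero_cancel_iff by linarith
    have ss: "s * s = of_nat (Suc n)"
      by (simp add: s_def flip: of_real_mult)
    have r1: "complex_of_real (sqrt (fact (Suc n))) = s * r"
      unfolding sqrt_fact_Suc by (simp add: s_def r_def)
    have r2: "complex_of_real (sqrt (fact (Suc (Suc n)))) = t * (s * r)"
      unfolding sqrt_fact_Suc[of "Suc n"] of_real_mult r1 by (simp add: t_def add_ac)
    have "(deriv ^^ Suc (Suc n)) g 0 = b * (deriv ^^ Suc n) g 0 + 2 * c * of_nat (Suc n) * (deriv ^^ n) g 0"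
      using higher_deriv_exp_quadratic[of n a b c 0] unfolding g by simp
    hence "t * (s * r) * x (n + 2) = b * (s * r * x (n + 1)) + 2 * c * (s * s) * (r * x n)"
      unfolding deriv_eq r1 r2 ss by (simp add: r_def)
    hence "(s * r) * (t * x (n + 2)) = (s * r) * (b * x (n + 1) + 2 * c * s * x n)"
      by (simp only: ring_distribs mult_ac)
    hence "t * x (n + 2) = b * x (n + 1) + 2 * c * s * x n"
      using r \<open>s \<noteq> 0\<close> by simp
    thus "of_real (sqrt (real n + 2)) * x (n + 2) = b * x (n + 1) + 2 * c * of_real (sqrt (real n + 1)) * x n"
      by (simp only: s_def t_def)
  qed
qed

theorem theorem34:
  fixes K :: "complex set"
  assumes "compact K" and "0 \<notin> K"
  shows "\<exists>r\<^sub>0::real. \<forall>\<phi>::nat \<Rightarrow> complex. (\<forall>n. \<phi> n \<in> K) \<longrightarrow>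
           (\<exists>z. norm z \<le> r\<^sub>0 \<and> g_series \<phi> z = 0)"
proof (rule ccontr)
  assume "\<not> ?thesis"
  \<comment> \<open>Only integer radii are tested: the failure of radius \<open>k\<close> yields a
    coefficient sequence whose series is zero-free on the disc of radius \<open>k\<close>.\<close>
  hence "\<forall>k::nat. \<exists>\<phi>. (\<forall>n. \<phi> n \<in> K) \<and> (\<forall>z. norm z \<le> real k \<longrightarrow> g_series \<phi> z \<noteq> 0)"
    by blast
  from choice[OF this] obtain \<phi> where \<phi>K: "\<And>k n. \<phi> k n \<in> K"
    and nz: "\<And>k z. norm z \<le> real k \<Longrightarrow> g_series (\<phi> k) z \<noteq> 0"
    by blast
  obtain M where M: "M > 0" "\<And>z. z \<in> K \<Longrightarrow> norm z \<le> M"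
    using compact_imp_bounded[OF \<open>compact K\<close>] by (auto simp: bounded_pos)
  obtain m where m: "m > 0" "\<And>z. z \<in> K \<Longrightarrow> m \<le> norm z"
    using separate_point_closed[OF compact_imp_closed[OF \<open>compact K\<close>] \<open>0 \<notin> K\<close>] by (auto simp: dist_norm)
  have bdd: "bounded (range (\<phi> k))" for k
    using compact_imp_bounded[OF \<open>compact K\<close>] by (rule bounded_subset) (use \<phi>K in auto)
  define F where "F k = g_series (\<phi> k)" for k
  have F_holo: "F k holomorphic_on S" for k S
    unfolding F_def by (rule holomorphic_on_subset[OF g_series_holomorphic[OF bdd]]) simp
  have F_le: "norm (F k z) \<le> 3 * M * exp (2 * (norm z)\<^sup>2)" for k z
    unfolding F_def using M \<phi>K by (intro cmod_g_series_le) auto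
  have F_deriv: "norm ((deriv ^^ n) (F k) 0) = norm (\<phi> k n) * sqrt (fact n)" for n k
    unfolding F_def higher_deriv_g_series[OF bdd] by (simp add: norm_mult)
  obtain g r where g_holo: "g holomorphic_on UNIV" and r: "strict_mono (r :: nat \<Rightarrow> nat)"
    and g_lim: "\<And>z. (\<lambda>n. F (r n) z) \<longlonglongrightarrow> g z"
    and g_ulim: "\<And>X. compact X \<Longrightarrow> uniform_limit X (F \<circ> r) g sequentially"
  proof (rule Montel[of UNIV "range F" F])
    show "\<exists>B. \<forall>h\<in>range F. \<forall>z\<in>X. norm (h z) \<le> B" if X: "compact X" for X
    proof -
      obtain R where R: "\<And>z. z \<in> X \<Longrightarrow> norm z \<le> R"
        using compact_imp_bounded[OF X] by (auto simp: bounded_iff)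
      have "norm (F k z) \<le> 3 * M * exp (2 * R\<^sup>2)" if "z \<in> X" for k z
      proof -
        have "exp (2 * (norm z)\<^sup>2) \<le> exp (2 * R\<^sup>2)"
          using R[OF that] by (simp add: power_mono)
        hence "3 * M * exp (2 * (norm z)\<^sup>2) \<le> 3 * M * exp (2 * R\<^sup>2)"
          using M(1) by simp
        thus ?thesis using F_le[of k z] by linarith
      qed
      thus ?thesis by blast
    qed
  qed (use F_holo in auto)
  have g_deriv_lim: "(\<lambda>k. norm ((deriv ^^ n) (F (r k)) 0)) \<longlonglongrightarrow> norm ((deriv ^^ n) g 0)" for n
  proof (intro tendsto_norm higher_deriv_complex_uniform_limit)
    show "uniform_limit (ball 0 1) (\<lambda>k. F (r k)) g sequentially"
      using uniform_limit_on_subset[OF g_ulim[of "cball 0 1"], of "ball 0 1"] by (simp add: o_def ball_subset_cball)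
  qed (simp_all add: F_holo)
  have g_deriv_ge: "m * sqrt (fact n) \<le> norm ((deriv ^^ n) g 0)" for n
    by (rule LIMSEQ_le_const[OF g_deriv_lim]) (auto simp: F_deriv m \<phi>K intro!: mult_right_mono)
  have g_deriv_le: "norm ((deriv ^^ n) g 0) \<le> M * sqrt (fact n)" for n
    by (rule LIMSEQ_le_const2[OF g_deriv_lim]) (auto simp: F_deriv M \<phi>K intro!: mult_right_mono)
  have "norm (g z) \<le> 3 * M * exp (2 * (norm z)\<^sup>2)" for z
    by (rule LIMSEQ_le_const2[OF tendsto_norm[OF g_lim]]) (auto intro: F_le)
  then obtain z where "g z = 0"
    using entire_has_zero[OF g_holo, of "3 * M" 2 m M] M(1) m(1) g_deriv_ge g_deriv_le by auto
  \<comment> \<open>Since \<open>r\<close> is strictly increasing, \<open>r (n + N)\<close> is at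
    least \<open>N\<close>, which exceeds the modulus of every point of \<open>B\<close>. Dropping
    \<open>N\<close> terms of the subsequence thus leaves functions without zeros in
    \<open>B\<close>, as Hurwitz's theorem requires.\<close>
  define N where "N = nat \<lceil>norm z + 1\<rceil>"
  define B where "B = ball (0 :: complex) (norm z + 1)"
  have B: "open B" "connected B" "0 \<in> B" "z \<in> B"
    by (auto simp: B_def add_nonneg_pos)
  have "g z \<noteq> 0"
  proof (rule Hurwitz_no_zeros[of B "\<lambda>n. F (r (n + N))" g z])
    show "g holomorphic_on B" using g_holo by (rule holomorphic_on_subset) simp
    show "uniform_limit X (\<lambda>n. F (r (n + N))) g sequentially" if "compact X" "X \<subseteq> B" for X
      using filterlim_compose[OF g_ulim[OF that(1)] filterlim_add_const_nat_at_top[of N]]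
      by (simp only: o_def)
    \<comment> \<open>The lower bound on the first derivative at 0, a point of \<open>B\<close>,
      excludes constancy.\<close>
    show "\<not> g constant_on B"
    proof
      assume "g constant_on B"
      then obtain v where "\<And>w. w \<in> B \<Longrightarrow> g w = v" by (auto simp: constant_on_def)
      hence "deriv g 0 = deriv (\<lambda>_. v) 0"
        using B(1,3) by (intro complex_derivative_transform_within_open[of g B])
          (auto intro: holomorphic_on_subset[OF g_holo])
      thus False using g_deriv_ge[of 1] m(1) by simp
    qed
    fix n w assume "w \<in> B"
    hence "norm w \<le> real N" by (simp add: B_def N_def) linarith
    also have "\<dots> \<le> real (r (n + N))"
      using seq_suble[OF r, of "n + N"] by simp
    finally show "F (r (n + N)) w \<noteq> 0" unfolding F_def by (rule nz)
  qed (use B F_holo in auto)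
  thus False using \<open>g z = 0\<close> by simp
qed

end
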